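(* For any $s<-1/4$ and any $a,b\in\mathbb{R}$ with $a<1/2$, the estimate $$\left\|\left(\frac{|n|^2\,\widetilde{uv}(\tau,n)}{2i\gamma(n)}\right)^{\sim^{-1}}\right\|_{X_{s,-a}}\le c\,\|u\|_{X_{s,b}}\,\|v\|_{X_{s,b}}$$ fails; that is, there is no constant $c>0$ for which this inequality holds for all $u,v\in X_{s,b}$.
   Context: $\mathbb{T}$ is the one-dimensional torus (periodic functions of $x$, with spatial frequency $n\in\mathbb{Z}$), $\langle y\rangle = 1+|y|$, and $\gamma(n)=\sqrt{n^2+n^4}$ for $n\in\mathbb{Z}$. The symbol $\sim$ denotes the space-time Fourier transform in $(x,t)\in\mathbb{T}\times\mathbb{R}$, with dual variables $n\in\mathbb{Z}$ and $\tau\in\mathbb{R}$, and $\sim^{-1}$ denotes the inverse space-time Fourier transform. The multiplier $|n|^2/\gamma(n)$ is taken to be $0$ at $n=0$. Let $\mathcal{Y}$ be the space of functions $F:\mathbb{T}\times\mathbb{R}\to\mathbb{C}$ such that $F(x,\cdot)$ belongs to the Schwartz space $S(\mathbb{R})$ for each $x\in\mathbb{T}$ and $F(\cdot,t)\in C^\infty(\mathbb{T})$ for each $t\in\mathbb{R}$. For $s,b\in\mathbb{R}$, $X_{s,b}$ is the completion of $\mathcal{Y}$ with respect to the norm $$\|F\|_{X_{s,b}}=\left\|\langle|\tau|-\gamma(n)\rangle^{b}\langle n\rangle^{s}\widetilde{F}(\tau,n)\right\|_{\ell^2_nL^2_\tau}.$$ $\widetilde{uv}$ is understood as the convolution of $\widetilde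 u$ and $\widetilde v$ in $(\tau,n)\in\mathbb{R}\times\mathbb{Z}$. *)

theory Defs
  imports "HOL-Analysis.Analysis"
begin

definition jbr :: "real \<Rightarrow> real"  (\<open>\<langle>_\<rangle>\<close>)
  where "\<langle>y\<rangle> = 1 + \<bar>y\<bar>"

definition gam :: "int \<Rightarrow> real"
  where "gam n = sqrt (real_of_int n ^ 2 + real_of_int n ^ 4)"

definition vderiv :: "(real \<Rightarrow> complex) \<Rightarrow> real \<Rightarrow> complex"
  where "vderiv f = (\<lambda>x. vector_derivative f (at x))"

definition smooth :: "(real \<Rightarrow> complex) \<Rightarrow> bool"
  where "smooth f \<longleftrightarrow> (\<forall>k x. ((vderiv ^^ k) f) differentiable (at x))"

definition schwartz :: "(real \<Rightarrow> complex) \<Rightarrow> bool"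
  where "schwartz f \<longleftrightarrow>
    smooth f \<and> (\<forall>j k. bounded (range (\<lambda>t. t ^ j *\<^sub>R (vderiv ^^ k) f t)))"

text \<open>The torus is \<open>\<real> / 2\<pi>\<int>\<close>; functions on it are \<open>2\<pi>\<close>-periodic functions on \<open>\<real>\<close>.
  The first argument of \<open>F\<close> is \<open>x\<close>, the second is \<open>t\<close>.\<close>

definition Y_space :: "(real \<Rightarrow> real \<Rightarrow> complex) set"
  where "Y_space = {F. (\<forall>x t. F (x + 2 * pi) t = F x t) \<and>
                       (\<forall>x. schwartz (F x)) \<and>
                       (\<forall>t. smooth (\<lambda>x. F x t))}"

text \<open>The separate conditions defining \<^const>\<open>Y_space\<close> do not by themselves make \<open>F\<close> integrable
  over one period times \<open>\<real>\<close>, so integrability is a separate predicate: it is what the space-time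
  Fourier integral needs.\<close>

definition st_integrable :: "(real \<Rightarrow> real \<Rightarrow> complex) \<Rightarrow> bool"
  where "st_integrable F \<longleftrightarrow>
    set_integrable (lborel \<Otimes>\<^sub>M lborel) ({0..2 * pi} \<times> UNIV) (\<lambda>(x, t). F x t)"

text \<open>Functions on the frequency side take \<open>(n, \<tau>)\<close>. The factor \<open>(2\<pi>)\<^sup>-\<^sup>2\<close> is the normalization for
  which the transform of a product is exactly the convolution of the transforms with respect to
  counting measure in \<open>n\<close> and Lebesgue measure in \<open>\<tau>\<close>.\<close>

definition st_fourier :: "(real \<Rightarrow> real \<Rightarrow> complex) \<Rightarrow> int \<times> real \<Rightarrow> complex"
  where "st_fourier F = (\<lambda>(n, \<tau>).
    (LINT (x, t) : {0..2 * pi} \<times> UNIV | lborel \<Otimes>\<^sub>M lborel.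
        exp (- \<i> * of_real (real_of_int n * x + \<tau> * t)) * F x t) / of_real ((2 * pi) ^ 2))"

definition freq_measure :: "(int \<times> real) measure"
  where "freq_measure = count_space UNIV \<Otimes>\<^sub>M lborel"

definition L2_norm :: "(int \<times> real \<Rightarrow> complex) \<Rightarrow> ennreal"
  where "L2_norm f =
    (let I = \<integral>\<^sup>+ p. ennreal ((cmod (f p))\<^sup>2) \<partial>freq_measure
     in if I = \<infinity> then \<infinity> else ennreal (sqrt (enn2real I)))"

text \<open>The \<open>X\<^sub>s\<^sub>,\<^sub>b\<close>-norm of the function or distribution whose space-time Fourier transform is
  \<open>f\<close>; in particular the norm of an inverse transform is \<open>X_norm\<close> of the symbol itself.
  The value is \<open>\<infinity>\<close> when the weighted function is not square integrable.\<close>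

definition X_norm :: "real \<Rightarrow> real \<Rightarrow> (int \<times> real \<Rightarrow> complex) \<Rightarrow> ennreal"
  where "X_norm s b f =
    L2_norm (\<lambda>(n, \<tau>). of_real (\<langle>\<bar>\<tau>\<bar> - gam n\<rangle> powr b * \<langle>real_of_int n\<rangle> powr s) * f (n, \<tau>))"

definition Y_normed :: "real \<Rightarrow> real \<Rightarrow> (real \<Rightarrow> real \<Rightarrow> complex) set"
  where "Y_normed s b = {F \<in> Y_space. st_integrable F \<and> X_norm s b (st_fourier F) < \<infinity>}"

text \<open>The completion of \<^const>\<open>Y_normed\<close>. Its elements are in general distributions, so each is
  given by its space-time Fourier transform: the transform maps \<^const>\<open>Y_normed\<close> isometrically into
  a weighted \<open>L\<^sup>2\<close> space, which is complete, and the completion is the closure of the image there.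
  As usual, functions equal almost everywhere represent the same element.\<close>

definition X_space :: "real \<Rightarrow> real \<Rightarrow> (int \<times> real \<Rightarrow> complex) set"
  where "X_space s b = {f \<in> borel_measurable freq_measure.
    \<exists>F :: nat \<Rightarrow> real \<Rightarrow> real \<Rightarrow> complex. (\<forall>k. F k \<in> Y_normed s b) \<and>
      (\<lambda>k. X_norm s b (\<lambda>p. st_fourier (F k) p - f p)) \<longlonglongrightarrow> 0}"

text \<open>At points where the convolution does not converge absolutely the Bochner integral is \<open>0\<close>, so
  such points can only decrease the norm of the product: a failing estimate is never due to a
  divergent convolution.\<close>

definition st_conv ::
    "(int \<times> real \<Rightarrow> complex) \<Rightarrow> (int \<times> real \<Rightarrow> complex) \<Rightarrow> int \<times> real \<Rightarrow> complex"
  where "st_conv f g = (\<lambda>(n, \<tau>). LINT (m, \<sigma>) | freq_measure. f (m, \<sigma>) * g (n - m, \<tau> - \<sigma>))"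

definition multiplier :: "int \<Rightarrow> complex"
  where "multiplier n =
    (if n = 0 then 0 else of_real (\<bar>real_of_int n\<bar>\<^sup>2) / (2 * \<i> * of_real (gam n)))"

end

theory Submission
  imports Defs "HOL-Probability.Probability" "HOL-Real_Asymp.Real_Asymp"
begin

text \<open>
  The estimate is violated by an interaction of two high frequencies that produces a low one.
  Take \<open>u\<close> to be a wave packet at spatial frequency \<open>N\<close> whose time frequency is concentrated in a
  bounded window around \<open>\<gamma>(N)\<close>, and \<open>v\<close> one at spatial frequency \<open>1 - N\<close> concentrated around
  \<open>-\<gamma>(1 - N)\<close>. Both sit on the set \<open>\<bar>\<tau>\<bar> = \<gamma>(n)\<close>, so the weight with exponent \<open>b\<close> contributes only
  a constant whatever the sign of \<open>b\<close>, and each norm is of order \<open>N\<^sup>s\<close>.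

  The product lives at spatial frequency \<open>1\<close>, where neither \<open>\<langle>n\<rangle>\<^sup>s\<close> nor the multiplier depends on \<open>N\<close>,
  and at time frequency about \<open>w = \<gamma>(N) - \<gamma>(1 - N)\<close>. The opposite signs make the quadratic parts
  cancel: since \<open>\<gamma>(n)\<close> differs from \<open>n\<^sup>2\<close> by at most \<open>1/2\<close>, \<open>w\<close> has size about \<open>2N\<close>. Thus
  \<open>\<langle>\<bar>\<tau>\<bar> - \<gamma>(1)\<rangle>\<close> is of order \<open>N\<close> there, and because \<open>a < 1/2\<close> the left-hand side is at least a constant
  times \<open>N\<^sup>-\<^sup>1\<^sup>/\<^sup>2\<close>. The estimate would force \<open>N\<^sup>-\<^sup>1\<^sup>/\<^sup>2 \<le> C N\<^sup>2\<^sup>s\<close> for all \<open>N \<ge> 1\<close>, which is impossible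
  for \<open>s < -1/4\<close>.

  Gaussian profiles in time make every quantity explicit. The packets are honest elements of
  \<^const>\<open>Y_space\<close>, so they lie in \<^const>\<open>X_space\<close> without any limiting argument; their transforms are
  Gaussians on a single line \<open>n = N\<close> (\<open>st_fourier_packet\<close>), the norms of these are bounded in
  \<open>X_norm_mode_le\<close>, their convolution is again a Gaussian on a single line (\<open>st_conv_mode\<close>), and
  \<open>X_norm_product_ge\<close> gives the lower bound on the product.
\<close>

section \<open>Products of one-variable functions\<close>

lemma (in pair_sigma_finite)
  fixes f :: "'a \<Rightarrow> complex" and g :: "'b \<Rightarrow> complex"
  assumes f: "integrable M1 f" and g: "integrable M2 g"
  shows integrable_tensor: "integrable (M1 \<Otimes>\<^sub>M M2) (\<lambda>(x, y). f x * g y)"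
    and integral_tensor:
      "(LINT (x, y) | (M1 \<Otimes>\<^sub>M M2). f x * g y) = integral\<^sup>L M1 f * integral\<^sup>L M2 g"
proof -
  have [measurable]: "f \<in> borel_measurable M1" "g \<in> borel_measurable M2"
    using f g by auto
  have m: "(\<lambda>(x, y). f x * g y) \<in> borel_measurable (M1 \<Otimes>\<^sub>M M2)"
    by measurable
  show int: "integrable (M1 \<Otimes>\<^sub>M M2) (\<lambda>(x, y). f x * g y)"
    using f g by (intro Fubini_integrable[OF m]) (auto simp: norm_mult)
  show "(LINT (x, y) | (M1 \<Otimes>\<^sub>M M2). f x * g y) = integral\<^sup>L M1 f * integral\<^sup>L M2 g"
    using integral_fst'[OF int] by simp
qed

interpretation freq: pair_sigma_finite "count_space (UNIV :: int set)" "lborel :: real measure"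
  by (intro pair_sigma_finite.intro sigma_finite_measure_count_space sigma_finite_lborel)

text \<open>All frequency-side functions below live on a single line \<open>n = N\<close>, so norms over
  \<^const>\<open>freq_measure\<close> reduce to integrals over the real line.\<close>

lemma nn_integral_freq_slice:
  assumes [measurable]: "g \<in> borel_measurable borel"
  shows "(\<integral>\<^sup>+ (n, \<tau>). (if n = N then g \<tau> else 0) \<partial>freq_measure) = (\<integral>\<^sup>+ \<tau>. g \<tau> \<partial>lborel)"
proof -
  have m: "(\<lambda>(n, \<tau>). if n = N then g \<tau> else 0) \<in> borel_measurable (count_space UNIV \<Otimes>\<^sub>M lborel)"
    by (rule measurable_pair_measure_countable1) auto
  have "(\<integral>\<^sup>+ (n, \<tau>). (if n = N then g \<tau> else 0) \<partial>freq_measure)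
      = (\<integral>\<^sup>+ n. \<integral>\<^sup>+ \<tau>. (if n = N then g \<tau> else 0) \<partial>lborel \<partial>count_space UNIV)"
    unfolding freq_measure_def using lborel.nn_integral_fst[OF m] by simp
  also have "\<dots> = (\<integral>\<^sup>+ n. (\<integral>\<^sup>+ \<tau>. g \<tau> \<partial>lborel) * indicator {N} n \<partial>count_space UNIV)"
    by (intro nn_integral_cong) (auto split: split_indicator)
  also have "\<dots> = (\<integral>\<^sup>+ \<tau>. g \<tau> \<partial>lborel)"
    by (subst nn_integral_indicator_singleton) auto
  finally show ?thesis .
qed

section \<open>Gaussian integrals\<close>

lemma has_bochner_integral_gaussian:
  assumes "c > 0"
  shows "has_bochner_integral lborel (\<lambda>x. exp (- c * (x - m)\<^sup>2)) (sqrt (pi / c))"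
proof -
  define d where "d = sqrt (1 / (2 * c))"
  have d: "d > 0" "d\<^sup>2 = 1 / (2 * c)" using assms by (auto simp: d_def)
  have "has_bochner_integral lborel (\<lambda>x. sqrt (pi / c) * normal_density m d x) (sqrt (pi / c) * 1)"
    by (intro has_bochner_integral_mult_right)
       (metis d(1) has_bochner_integral_integral_eq has_bochner_integral_integrable
         integrable_normal_density integral_normal_density)
  moreover have "sqrt (pi / c) * normal_density m d x = exp (- c * (x - m)\<^sup>2)" for x
    using assms by (simp add: normal_density_def d(2) field_simps real_sqrt_divide)
  ultimately show ?thesis by simp
qed

lemma integrable_gaussian: "integrable lborel (\<lambda>x :: real. exp (- (x - m)\<^sup>2 / 2))"
  using has_bochner_integral_gaussian[of "1/2" m]
  by (auto simp: has_bochner_integral_iff)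

text \<open>Up to normalization this is the characteristic function of the standard normal
  distribution.\<close>

lemma gaussian_fourier:
  fixes w :: real
  shows "(LINT t | lborel. exp (\<i> * of_real (w * t)) * of_real (exp (- t\<^sup>2 / 2)))
    = complex_of_real (sqrt (2 * pi) * exp (- w\<^sup>2 / 2))"
proof -
  have "complex_of_real (exp (- w\<^sup>2 / 2)) = char std_normal_distribution w"
    by (simp add: char_std_normal_distribution)
  also have "\<dots> = (LINT t | lborel. std_normal_density t *\<^sub>R iexp (w * t))"
    unfolding char_def by (subst integral_density) (auto simp: normal_density_nonneg)
  also have "\<dots> = (LINT t | lborel. complex_of_real (1 / sqrt (2 * pi)) *
        (exp (\<i> * of_real (w * t)) * of_real (exp (- t\<^sup>2 / 2))))"
    by (intro Bochner_Integration.integral_cong)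
       (auto simp: std_normal_density_def scaleR_conv_of_real mult_ac)
  also have "\<dots> = complex_of_real (1 / sqrt (2 * pi)) *
      (LINT t | lborel. exp (\<i> * of_real (w * t)) * of_real (exp (- t\<^sup>2 / 2)))"
    by simp
  finally show ?thesis by (simp add: field_simps)
qed

text \<open>Completing the square in \<open>\<sigma>\<close>: the product of the two Gaussians is a Gaussian in \<open>\<sigma>\<close> around
  the midpoint \<open>(p + \<tau> - q) / 2\<close>, times a factor that does not depend on \<open>\<sigma>\<close>.\<close>

lemma gaussian_convolution:
  fixes \<tau> p q :: real
  shows "(LINT \<sigma> | lborel. exp (- (\<sigma> - p)\<^sup>2 / 2) * exp (- (\<tau> - \<sigma> - q)\<^sup>2 / 2))
    = sqrt pi * exp (- (\<tau> - (p + q))\<^sup>2 / 4)"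
proof -
  have "exp (- (\<sigma> - p)\<^sup>2 / 2) * exp (- (\<tau> - \<sigma> - q)\<^sup>2 / 2)
      = exp (- (\<tau> - (p + q))\<^sup>2 / 4) * exp (- 1 * (\<sigma> - (p + \<tau> - q) / 2)\<^sup>2)" for \<sigma>
    unfolding exp_add[symmetric] by (rule arg_cong[where f = exp]) (simp add: power2_eq_square field_simps)
  then show ?thesis
    using has_bochner_integral_gaussian[of 1 "(p + \<tau> - q) / 2"]
    by (simp add: has_bochner_integral_iff)
qed

section \<open>Smoothness and decay of polynomials times quadratic exponentials\<close>

text \<open>A family closed under differentiation that contains both factors of a wave packet: the time
  profile with \<open>\<beta> = 1\<close> and the spatial oscillation with \<open>\<beta> = 0\<close>.\<close>

definition exp_poly :: "complex poly \<Rightarrow> complex \<Rightarrow> complex \<Rightarrow> real \<Rightarrow> complex"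
  where "exp_poly p \<alpha> \<beta> t = poly p (of_real t) * exp (\<alpha> * of_real t - \<beta> * (of_real t)\<^sup>2 / 2)"

lemma exp_poly_deriv:
  "(exp_poly p \<alpha> \<beta> has_vector_derivative exp_poly (pderiv p + [:\<alpha>, - \<beta>:] * p) \<alpha> \<beta> t) (at t)"
proof -
  have "((\<lambda>z. poly p z * exp (\<alpha> * z - \<beta> * z\<^sup>2 / 2)) has_field_derivative
      poly (pderiv p + [:\<alpha>, - \<beta>:] * p) z * exp (\<alpha> * z - \<beta> * z\<^sup>2 / 2)) (at z)" for z
    by (auto intro!: derivative_eq_intros poly_DERIV simp: algebra_simps)
  from has_vector_derivative_real_field[OF this] show ?thesis
    unfolding exp_poly_def .
qed

lemma vderiv_funpow_exp_poly: "\<exists>q. (vderiv ^^ k) (exp_poly p \<alpha> \<beta>) = exp_poly q \<alpha> \<beta>"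
proof (induction k)
  case (Suc k)
  then obtain q where "(vderiv ^^ k) (exp_poly p \<alpha> \<beta>) = exp_poly q \<alpha> \<beta>" ..
  moreover have "vderiv (exp_poly q \<alpha> \<beta>) = exp_poly (pderiv q + [:\<alpha>, - \<beta>:] * q) \<alpha> \<beta>"
    unfolding vderiv_def by (intro ext vector_derivative_at exp_poly_deriv)
  ultimately show ?case by auto
qed auto

lemma smooth_exp_poly: "smooth (exp_poly p \<alpha> \<beta>)"
  unfolding smooth_def
  by (metis exp_poly_deriv differentiableI_vector vderiv_funpow_exp_poly)

text \<open>One term of the exponential series gives \<open>\<bar>t\<bar>\<^sup>j \<le> j! e\<^bsup>\<bar>t\<bar>\<^esup>\<close>, and \<open>\<bar>t\<bar> - t\<^sup>2 / 2 \<le> 1 / 2\<close> because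
  \<open>(\<bar>t\<bar> - 1)\<^sup>2 \<ge> 0\<close>.\<close>

lemma power_times_gaussian_bound:
  fixes t :: real
  shows "\<bar>t\<bar> ^ j * exp (- t\<^sup>2 / 2) \<le> fact j * exp (1 / 2)"
proof -
  have "\<bar>t\<bar> ^ j \<le> fact j * exp \<bar>t\<bar>"
  proof -
    have "(\<Sum>n\<in>{j}. \<bar>t\<bar> ^ n /\<^sub>R fact n) \<le> (\<Sum>n. \<bar>t\<bar> ^ n /\<^sub>R fact n)"
      by (rule sum_le_suminf[OF summable_exp_generic]) auto
    then show ?thesis by (simp add: exp_def field_simps)
  qed
  then have "\<bar>t\<bar> ^ j * exp (- t\<^sup>2 / 2) \<le> fact j * (exp \<bar>t\<bar> * exp (- t\<^sup>2 / 2))"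
    by (simp add: mult_right_mono flip: mult.assoc)
  also have "exp \<bar>t\<bar> * exp (- t\<^sup>2 / 2) \<le> exp (1 / 2)"
    unfolding exp_add[symmetric]
    using zero_le_power2[of "\<bar>t\<bar> - 1"] by (simp add: power2_diff)
  finally show ?thesis by simp
qed

text \<open>The extra factor \<open>\<bar>t\<bar>\<^sup>j\<close> makes the induction over the coefficients go through: splitting
  off the constant coefficient moves one factor \<open>t\<close> from the polynomial into the power.\<close>

lemma poly_times_gaussian_bounded:
  fixes p :: "complex poly"
  shows "\<exists>C. \<forall>t :: real. \<bar>t\<bar> ^ j * cmod (poly p (of_real t)) * exp (- t\<^sup>2 / 2) \<le> C"
proof (induction p arbitrary: j)
  case 0
  then show ?case by auto
next
  case (pCons a p)
  obtain C where C: "\<bar>t\<bar> ^ Suc j * cmod (poly p (of_real t)) * exp (- t\<^sup>2 / 2) \<le> C" for t :: real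
    using pCons.IH[of "Suc j"] by blast
  have "\<bar>t\<bar> ^ j * cmod (poly (pCons a p) (of_real t)) * exp (- t\<^sup>2 / 2)
      \<le> cmod a * (fact j * exp (1 / 2)) + C" for t :: real
  proof -
    have "cmod (poly (pCons a p) (of_real t)) \<le> cmod a + \<bar>t\<bar> * cmod (poly p (of_real t))"
      by (simp add: norm_triangle_ineq[THEN order_trans] norm_mult)
    then have "\<bar>t\<bar> ^ j * cmod (poly (pCons a p) (of_real t)) * exp (- t\<^sup>2 / 2)
        \<le> \<bar>t\<bar> ^ j * (cmod a + \<bar>t\<bar> * cmod (poly p (of_real t))) * exp (- t\<^sup>2 / 2)"
      by (intro mult_right_mono mult_left_mono) auto
    also have "\<dots> = cmod a * (\<bar>t\<bar> ^ j * exp (- t\<^sup>2 / 2))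
        + \<bar>t\<bar> ^ Suc j * cmod (poly p (of_real t)) * exp (- t\<^sup>2 / 2)"
      by (simp add: algebra_simps)
    also have "\<dots> \<le> cmod a * (fact j * exp (1 / 2)) + C"
      by (intro add_mono mult_left_mono power_times_gaussian_bound C) auto
    finally show ?thesis .
  qed
  then show ?case by blast
qed

lemma schwartz_exp_poly:
  assumes "Re \<alpha> = 0"
  shows "schwartz (exp_poly p \<alpha> 1)"
  unfolding schwartz_def
proof (intro conjI allI smooth_exp_poly)
  fix j k
  obtain q where q: "(vderiv ^^ k) (exp_poly p \<alpha> 1) = exp_poly q \<alpha> 1"
    using vderiv_funpow_exp_poly by blast
  obtain C where C: "\<bar>t\<bar> ^ j * cmod (poly q (of_real t)) * exp (- t\<^sup>2 / 2) \<le> C" for t :: real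
    using poly_times_gaussian_bounded[of j q] by blast
  have "Re (\<alpha> * of_real t - 1 * (of_real t)\<^sup>2 / 2) = - t\<^sup>2 / 2" for t :: real
    using assms by (simp flip: of_real_power)
  then have "norm (t ^ j *\<^sub>R exp_poly q \<alpha> 1 t) = \<bar>t\<bar> ^ j * cmod (poly q (of_real t)) * exp (- t\<^sup>2 / 2)"
    for t by (simp add: exp_poly_def norm_mult power_abs)
  then show "bounded (range (\<lambda>t. t ^ j *\<^sub>R (vderiv ^^ k) (exp_poly p \<alpha> 1) t))"
    unfolding q using C by (auto intro!: boundedI)
qed

section \<open>Wave packets and their transforms\<close>

text \<open>The constant \<open>sqrt (2 * pi)\<close> is chosen so that the transform of a packet is \<open>mode\<close> with
  amplitude exactly \<open>1\<close>, in the normalization of \<^const>\<open>st_fourier\<close>.\<close>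

definition packet :: "int \<Rightarrow> real \<Rightarrow> real \<Rightarrow> real \<Rightarrow> complex"
  where "packet N \<omega> x t = of_real (sqrt (2 * pi)) * exp (\<i> * of_real (of_int N * x))
    * (exp (\<i> * of_real (\<omega> * t)) * of_real (exp (- t\<^sup>2 / 2)))"

definition mode :: "int \<Rightarrow> real \<Rightarrow> int \<times> real \<Rightarrow> complex"
  where "mode N \<omega> = (\<lambda>(n, \<tau>). if n = N then of_real (exp (- (\<tau> - \<omega>)\<^sup>2 / 2)) else 0)"

lemma packet_in_Y_space: "packet N \<omega> \<in> Y_space"
proof -
  have t: "packet N \<omega> x = exp_poly [:of_real (sqrt (2 * pi)) * exp (\<i> * of_real (of_int N * x)):]
      (\<i> * of_real \<omega>) 1" for x
  proof
    fix t
    have "exp (\<i> * of_real (\<omega> * t)) * of_real (exp (- t\<^sup>2 / 2))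
        = exp (\<i> * of_real \<omega> * of_real t - 1 * (complex_of_real t)\<^sup>2 / 2)"
      by (simp add: exp_of_real[symmetric] exp_add[symmetric] mult.assoc)
    then show "packet N \<omega> x t = exp_poly [:of_real (sqrt (2 * pi)) *
        exp (\<i> * of_real (of_int N * x)):] (\<i> * of_real \<omega>) 1 t"
      by (simp add: packet_def exp_poly_def)
  qed
  have x: "(\<lambda>x. packet N \<omega> x t) = exp_poly [:of_real (sqrt (2 * pi)) *
      (exp (\<i> * of_real (\<omega> * t)) * of_real (exp (- t\<^sup>2 / 2))):] (\<i> * of_int N) 0" for t
    by (auto simp: packet_def exp_poly_def mult_ac)
  have "exp (\<i> * of_real (of_int N * (x + 2 * pi))) = exp (\<i> * complex_of_real (of_int N * x))" for x
    using exp_plus_2pin[of "\<i> * complex_of_real (of_int N * x)" N] by (simp add: algebra_simps)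
  then have "packet N \<omega> (x + 2 * pi) t = packet N \<omega> x t" for x t
    by (simp add: packet_def)
  moreover have "schwartz (packet N \<omega> x)" for x
    unfolding t by (rule schwartz_exp_poly) simp
  moreover have "smooth (\<lambda>x. packet N \<omega> x t)" for t
    unfolding x by (rule smooth_exp_poly)
  ultimately show ?thesis by (simp add: Y_space_def)
qed

lemma torus_orthogonality:
  "(LINT x : {0..2 * pi} | lborel. exp (\<i> * of_real (of_int k * x)))
    = (if k = 0 then of_real (2 * pi) else 0)"
proof (cases "k = 0")
  case True
  then show ?thesis by (simp add: set_lebesgue_integral_def scaleR_conv_of_real)
next
  case False
  have "(LINT x : {0..2 * pi} | lborel. exp (\<i> * of_real (of_int k * x)))
      = exp (\<i> * of_int k * of_real (2 * pi)) / (\<i> * of_int k)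
        - exp (\<i> * of_int k * of_real 0) / (\<i> * of_int k)"
    unfolding set_lebesgue_integral_def
  proof (rule integral_FTC_Icc)
    fix x :: real
    have "((\<lambda>z. exp (\<i> * of_int k * z) / (\<i> * of_int k)) has_field_derivative
        exp (\<i> * of_int k * z)) (at z)" for z
      using False by (auto intro!: derivative_eq_intros)
    from has_vector_derivative_real_field[OF this]
    show "((\<lambda>x. exp (\<i> * of_int k * of_real x) / (\<i> * of_int k)) has_vector_derivative
        exp (\<i> * of_real (of_int k * x))) (at x within {0..2 * pi})"
      by (simp add: mult_ac)
  qed (auto intro!: continuous_intros)
  also have "exp (\<i> * of_int k * of_real (2 * pi)) = 1"
    using exp_plus_2pin[of 0 k] by (simp add: algebra_simps)
  finally show ?thesis using False by simp
qed

lemma integrable_torus_exp: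
  "integrable lborel (\<lambda>x. indicator {0..2 * pi} x *\<^sub>R exp (\<i> * complex_of_real (of_int k * x)))"
  by (intro borel_integrable_compact continuous_intros compact_Icc)

lemma integrable_gaussian_exp:
  "integrable lborel (\<lambda>t. exp (\<i> * of_real (w * t)) * complex_of_real (exp (- t\<^sup>2 / 2)))"
proof (rule Bochner_Integration.integrable_bound)
  show "integrable lborel (\<lambda>t :: real. exp (- (t - 0)\<^sup>2 / 2))" by (rule integrable_gaussian)
qed (auto simp: norm_mult)

text \<open>Separation of variables in the Fourier integrand. The case \<open>n = 0\<close>, \<open>\<tau> = 0\<close> is the packet
  itself, so that integrability and the transform follow from the same identity.\<close>

lemma packet_modulated:
  "indicator ({0..2 * pi} \<times> UNIV) (x, t) *\<^sub>R
      (exp (- \<i> * of_real (of_int n * x + \<tau> * t)) * packet N \<omega> x t)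
    = (of_real (sqrt (2 * pi)) * (indicator {0..2 * pi} x *\<^sub>R exp (\<i> * of_real (of_int (N - n) * x))))
      * (exp (\<i> * of_real ((\<omega> - \<tau>) * t)) * of_real (exp (- t\<^sup>2 / 2)))"
proof -
  have "exp (- \<i> * of_real (of_int n * x + \<tau> * t))
        * (exp (\<i> * of_real (of_int N * x)) * exp (\<i> * of_real (\<omega> * t)))
      = exp (\<i> * of_real (of_int (N - n) * x)) * exp (\<i> * complex_of_real ((\<omega> - \<tau>) * t))"
    unfolding exp_add[symmetric] by (rule arg_cong[where f = exp]) (simp add: algebra_simps)
  then show ?thesis
    by (simp add: packet_def indicator_times mult_ac scaleR_conv_of_real)
qed

lemma st_integrable_packet: "st_integrable (packet N \<omega>)"
proof -
  have "integrable (lborel \<Otimes>\<^sub>M lborel) (\<lambda>(x, t).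
      (of_real (sqrt (2 * pi)) * (indicator {0..2 * pi} x *\<^sub>R exp (\<i> * of_real (of_int (N - 0) * x))))
      * (exp (\<i> * of_real ((\<omega> - 0) * t)) * complex_of_real (exp (- t\<^sup>2 / 2))))"
    by (intro lborel_pair.integrable_tensor integrable_mult_right integrable_torus_exp
        integrable_gaussian_exp)
  then show ?thesis
    unfolding st_integrable_def set_integrable_def packet_modulated[symmetric]
    by (simp add: case_prod_unfold)
qed

lemma st_fourier_packet: "st_fourier (packet N \<omega>) = mode N \<omega>"
proof (rule ext, clarify)
  fix n \<tau>
  let ?f = "\<lambda>x. complex_of_real (sqrt (2 * pi)) *
    (indicator {0..2 * pi} x *\<^sub>R exp (\<i> * of_real (of_int (N - n) * x)))"
  let ?g = "\<lambda>t. exp (\<i> * of_real ((\<omega> - \<tau>) * t)) * complex_of_real (exp (- t\<^sup>2 / 2))"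
  have "(LINT (x, t) : {0..2 * pi} \<times> UNIV | lborel \<Otimes>\<^sub>M lborel.
        exp (- \<i> * of_real (real_of_int n * x + \<tau> * t)) * packet N \<omega> x t)
      = (LINT (x, t) | (lborel \<Otimes>\<^sub>M lborel). ?f x * ?g t)"
    unfolding set_lebesgue_integral_def packet_modulated[symmetric]
    by (simp add: case_prod_unfold)
  also have "\<dots> = integral\<^sup>L lborel ?f * integral\<^sup>L lborel ?g"
    by (intro lborel_pair.integral_tensor integrable_mult_right integrable_torus_exp
        integrable_gaussian_exp)
  also have "integral\<^sup>L lborel ?f
      = of_real (sqrt (2 * pi)) * (if n = N then of_real (2 * pi) else 0)"
    unfolding integral_mult_right_zero
    using torus_orthogonality[of "N - n"] by (auto simp: set_lebesgue_integral_def)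
  also have "integral\<^sup>L lborel ?g = of_real (sqrt (2 * pi) * exp (- (\<omega> - \<tau>)\<^sup>2 / 2))"
    by (rule gaussian_fourier)
  finally have "st_fourier (packet N \<omega>) (n, \<tau>) = (of_real (sqrt (2 * pi)) *
      (if n = N then of_real (2 * pi) else 0) * of_real (sqrt (2 * pi) * exp (- (\<omega> - \<tau>)\<^sup>2 / 2)))
      / of_real ((2 * pi) ^ 2)"
    by (simp add: st_fourier_def)
  also have "\<dots> = (if n = N then of_real ((sqrt (2 * pi))\<^sup>2 * (2 * pi) * exp (- (\<omega> - \<tau>)\<^sup>2 / 2)
      / (2 * pi) ^ 2) else 0)"
    by (cases "n = N") (simp_all only: of_real_mult of_real_divide of_real_power power2_eq_square
      mult_ac if_True if_False simp_thms mult_zero_left mult_zero_right div_0)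
  also have "(sqrt (2 * pi))\<^sup>2 * (2 * pi) * exp (- (\<omega> - \<tau>)\<^sup>2 / 2) / (2 * pi) ^ 2
      = exp (- (\<tau> - \<omega>)\<^sup>2 / 2)"
    by (simp add: power2_eq_square field_simps)
  finally show "st_fourier (packet N \<omega>) (n, \<tau>) = mode N \<omega> (n, \<tau>)"
    by (simp add: mode_def)
qed

section \<open>Norms\<close>

lemma L2_norm_le:
  assumes "(\<integral>\<^sup>+ p. ennreal ((cmod (f p))\<^sup>2) \<partial>freq_measure) \<le> ennreal (C\<^sup>2)" and "C \<ge> 0"
  shows "L2_norm f \<le> ennreal C"
proof -
  let ?I = "\<integral>\<^sup>+ p. ennreal ((cmod (f p))\<^sup>2) \<partial>freq_measure"
  have fin: "?I \<noteq> \<infinity>" using assms(1) by (auto simp: top_unique)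
  have "enn2real ?I \<le> C\<^sup>2" using assms(1) by (simp add: enn2real_leI)
  then have "sqrt (enn2real ?I) \<le> C" using assms(2) by (simp add: real_le_lsqrt)
  then show ?thesis using fin by (simp add: L2_norm_def Let_def ennreal_leI)
qed

lemma L2_norm_ge:
  assumes "ennreal (C\<^sup>2) \<le> (\<integral>\<^sup>+ p. ennreal ((cmod (f p))\<^sup>2) \<partial>freq_measure)"
  shows "ennreal C \<le> L2_norm f"
proof -
  let ?I = "\<integral>\<^sup>+ p. ennreal ((cmod (f p))\<^sup>2) \<partial>freq_measure"
  show ?thesis
  proof (cases "?I = \<infinity>")
    case True
    then show ?thesis by (simp add: L2_norm_def)
  next
    case False
    then obtain r where r: "?I = ennreal r" "r \<ge> 0" by (cases ?I) auto
    then have "C\<^sup>2 \<le> enn2real ?I" using assms by simp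
    then have "C \<le> sqrt (enn2real ?I)" using real_le_rsqrt by blast
    then show ?thesis using False by (simp add: L2_norm_def Let_def ennreal_leI)
  qed
qed

lemma X_norm_zero: "X_norm s b (\<lambda>_. 0) = 0"
  by (simp add: X_norm_def L2_norm_def case_prod_unfold)

lemma jbr_ge_1: "\<langle>y\<rangle> \<ge> 1"
  by (simp add: jbr_def)

text \<open>A Gaussian absorbs any power of the weight, at the price of a constant depending only on the
  exponent: \<open>0 \<le> ln \<langle>z\<rangle> \<le> \<bar>z\<bar>\<close> turns the power into \<open>e\<^bsup>\<bar>b\<bar> \<bar>y\<bar>\<^esup>\<close>, and
  \<open>2 \<bar>b\<bar> \<bar>y\<bar> \<le> 2 b\<^sup>2 + y\<^sup>2 / 2\<close>. Both signs of \<open>b\<close> are covered at once.\<close>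

lemma jbr_powr_gaussian_bound:
  fixes b y z :: real
  assumes "\<bar>z\<bar> \<le> \<bar>y\<bar>"
  shows "(\<langle>z\<rangle> powr b * exp (- y\<^sup>2 / 2))\<^sup>2 \<le> exp (2 * b\<^sup>2) * exp (- y\<^sup>2 / 2)"
proof -
  have "ln \<langle>z\<rangle> \<ge> 0" "ln \<langle>z\<rangle> \<le> \<bar>y\<bar>"
    using assms jbr_ge_1[of z] ln_add_one_self_le_self[of "\<bar>z\<bar>"] by (auto simp: jbr_def)
  then have "b * ln \<langle>z\<rangle> \<le> \<bar>b\<bar> * \<bar>y\<bar>"
    by (meson abs_ge_self abs_ge_zero mult_mono)
  then have "2 * (b * ln \<langle>z\<rangle>) \<le> 2 * (\<bar>b\<bar> * \<bar>y\<bar>)" by simp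
  also have "\<dots> \<le> 2 * b\<^sup>2 + y\<^sup>2 / 2"
    using zero_le_power2[of "2 * \<bar>b\<bar> - \<bar>y\<bar>"] by (simp add: power2_diff power_mult_distrib)
  finally have "2 * (b * ln \<langle>z\<rangle> - y\<^sup>2 / 2) \<le> 2 * b\<^sup>2 - y\<^sup>2 / 2"
    by (simp add: right_diff_distrib)
  moreover have "\<langle>z\<rangle> powr b * exp (- y\<^sup>2 / 2) = exp (b * ln \<langle>z\<rangle> - y\<^sup>2 / 2)"
    using jbr_ge_1[of z] by (simp add: powr_def flip: exp_add)
  ultimately show ?thesis
    by (simp add: exp_double[symmetric] exp_add[symmetric])
qed

text \<open>If the centre \<open>\<omega>\<close> is on the curve \<open>\<bar>\<tau>\<bar> = \<gamma>(N)\<close>, then \<open>\<bar>\<bar>\<tau>\<bar> - \<gamma>(N)\<bar> \<le> \<bar>\<tau> - \<omega>\<bar>\<close> for either sign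
  of \<open>\<omega>\<close>. The weight with exponent \<open>b\<close> is therefore absorbed by the Gaussian uniformly in \<open>N\<close>, and
  only \<open>\<langle>N\<rangle>\<^sup>s\<close> remains.\<close>

lemma X_norm_mode_le:
  assumes "\<bar>\<omega>\<bar> = gam N"
  shows "X_norm s b (mode N \<omega>) \<le> ennreal (sqrt (exp (2 * b\<^sup>2) * sqrt (2 * pi)) * \<langle>of_int N\<rangle> powr s)"
proof -
  define S where "S = \<langle>of_int N\<rangle> powr s"
  define E where "E = exp (2 * b\<^sup>2)"
  have gint: "(\<integral>\<^sup>+ \<tau>. ennreal (exp (- (\<tau> - \<omega>)\<^sup>2 / 2)) \<partial>lborel) = ennreal (sqrt (2 * pi))"
    using has_bochner_integral_gaussian[of "1/2" \<omega>]
    by (subst nn_integral_eq_integral[OF integrable_gaussian])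
       (auto simp: has_bochner_integral_iff mult.commute)
  have pt: "(cmod (of_real (\<langle>\<bar>\<tau>\<bar> - gam n\<rangle> powr b * \<langle>of_int n\<rangle> powr s) * mode N \<omega> (n, \<tau>)))\<^sup>2
      \<le> (if n = N then S\<^sup>2 * E * exp (- (\<tau> - \<omega>)\<^sup>2 / 2) else 0)" for n \<tau>
  proof (cases "n = N")
    case True
    have "\<bar>\<bar>\<tau>\<bar> - gam N\<bar> \<le> \<bar>\<tau> - \<omega>\<bar>" unfolding assms[symmetric] by simp
    from jbr_powr_gaussian_bound[OF this, of b]
    have "S\<^sup>2 * (\<langle>\<bar>\<tau>\<bar> - gam N\<rangle> powr b * exp (- (\<tau> - \<omega>)\<^sup>2 / 2))\<^sup>2
        \<le> S\<^sup>2 * (E * exp (- (\<tau> - \<omega>)\<^sup>2 / 2))"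
      unfolding E_def by (intro mult_left_mono) auto
    then show ?thesis
      using True by (simp add: mode_def norm_mult S_def power_mult_distrib mult_ac)
  qed (simp add: mode_def)
  have "(\<integral>\<^sup>+ p. ennreal ((cmod ((\<lambda>(n, \<tau>). of_real (\<langle>\<bar>\<tau>\<bar> - gam n\<rangle> powr b * \<langle>of_int n\<rangle> powr s)
        * mode N \<omega> (n, \<tau>)) p))\<^sup>2) \<partial>freq_measure)
      \<le> (\<integral>\<^sup>+ (n, \<tau>). (if n = N then ennreal (S\<^sup>2 * E * exp (- (\<tau> - \<omega>)\<^sup>2 / 2)) else 0) \<partial>freq_measure)"
  proof (intro nn_integral_mono, clarify)
    fix n \<tau>
    show "ennreal ((cmod (of_real (\<langle>\<bar>\<tau>\<bar> - gam n\<rangle> powr b * \<langle>of_int n\<rangle> powr s) * mode N \<omega> (n, \<tau>)))\<^sup>2)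
        \<le> (if n = N then ennreal (S\<^sup>2 * E * exp (- (\<tau> - \<omega>)\<^sup>2 / 2)) else 0)"
      using ennreal_leI[OF pt[of \<tau> n]] by (cases "n = N") simp_all
  qed
  also have "\<dots> = (\<integral>\<^sup>+ \<tau>. ennreal (S\<^sup>2 * E * exp (- (\<tau> - \<omega>)\<^sup>2 / 2)) \<partial>lborel)"
    by (rule nn_integral_freq_slice) auto
  also have "\<dots> = ennreal (S\<^sup>2 * E) * ennreal (sqrt (2 * pi))"
    unfolding gint[symmetric]
    by (subst nn_integral_cmult[symmetric]) (auto simp: ennreal_mult E_def)
  also have "\<dots> = ennreal ((sqrt (E * sqrt (2 * pi)) * S)\<^sup>2)"
    by (simp add: ennreal_mult[symmetric] power_mult_distrib E_def mult_ac)
  finally show ?thesis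
    unfolding X_norm_def S_def[symmetric] E_def[symmetric]
    by (rule L2_norm_le) (auto simp: S_def E_def)
qed

lemma mode_measurable: "mode N \<omega> \<in> borel_measurable freq_measure"
  unfolding freq_measure_def by (rule measurable_pair_measure_countable1) (auto simp: mode_def)

lemma mode_in_X_space:
  assumes "\<bar>\<omega>\<bar> = gam N"
  shows "mode N \<omega> \<in> X_space s b"
proof -
  have "packet N \<omega> \<in> Y_normed s b"
    using X_norm_mode_le[OF assms, of s b]
    by (simp add: Y_normed_def packet_in_Y_space st_integrable_packet st_fourier_packet
        order_le_less_trans)
  then show ?thesis
    unfolding X_space_def
    by (auto simp: mode_measurable st_fourier_packet X_norm_zero intro!: exI[of _ "\<lambda>_. packet N \<omega>"])
qed

section \<open>The interaction of two modes\<close>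

lemma st_conv_mode:
  "st_conv (mode N p) (mode M q) (N + M, \<tau>)
    = of_real (sqrt pi * exp (- (\<tau> - (p + q))\<^sup>2 / 4))"
proof -
  let ?g = "\<lambda>\<sigma>. exp (- (\<sigma> - p)\<^sup>2 / 2) * exp (- (\<tau> - \<sigma> - q)\<^sup>2 / 2)"
  let ?f = "\<lambda>m. if m = N then 1 else 0 :: complex"
  have "has_bochner_integral (count_space UNIV) ?f 1"
    using has_bochner_integral_indicator[of "{N}" "count_space UNIV" "1 :: complex"]
    by (simp add: indicator_def of_bool_def if_distrib[of "\<lambda>r. r *\<^sub>R _"] cong: if_cong)
  then have f: "integrable (count_space UNIV) ?f" "integral\<^sup>L (count_space UNIV) ?f = 1"
    by (auto simp: has_bochner_integral_iff)
  have g: "integrable lborel (\<lambda>\<sigma>. complex_of_real (?g \<sigma>))"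
  proof (intro integrable_of_real Bochner_Integration.integrable_bound[OF integrable_gaussian[of p]] AE_I2)
    show "norm (?g \<sigma>) \<le> norm (exp (- (\<sigma> - p)\<^sup>2 / 2))" for \<sigma>
      by (simp add: mult_left_le)
  qed auto
  have "st_conv (mode N p) (mode M q) (N + M, \<tau>)
      = (LINT (m, \<sigma>) | freq_measure. ?f m * complex_of_real (?g \<sigma>))"
    unfolding st_conv_def prod.case
    by (intro Bochner_Integration.integral_cong) (auto simp: mode_def)
  also have "\<dots> = integral\<^sup>L (count_space UNIV) ?f * (LINT \<sigma> | lborel. complex_of_real (?g \<sigma>))"
    unfolding freq_measure_def by (rule freq.integral_tensor[OF f(1) g])
  also note f(2)
  also have "(LINT \<sigma> | lborel. complex_of_real (?g \<sigma>)) = of_real (LINT \<sigma> | lborel. ?g \<sigma>)"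
    by (rule integral_complex_of_real)
  finally show ?thesis by (simp only: gaussian_convolution mult_1)
qed

lemma gam_bounds: "(of_int n)\<^sup>2 \<le> gam n" "gam n \<le> (of_int n)\<^sup>2 + 1 / 2"
proof -
  show "(of_int n)\<^sup>2 \<le> gam n"
    unfolding gam_def by (rule real_le_rsqrt) (simp flip: power_mult)
  show "gam n \<le> (of_int n)\<^sup>2 + 1 / 2"
    unfolding gam_def by (rule real_le_lsqrt) (auto simp: power2_eq_square algebra_simps power4_eq_xxxx)
qed

text \<open>It suffices to look at the window \<open>{w..w + 1}\<close> on the line \<open>n = 1\<close>, of measure \<open>1\<close>. There the
  convolution is bounded below, and \<open>\<bar>w\<bar> \<le> 2N\<close> gives \<open>\<langle>\<bar>\<tau>\<bar> - \<gamma>(1)\<rangle> \<le> 5N\<close>. As the bracket is at least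
  \<open>1\<close>, its power \<open>-a\<close> dominates its power \<open>-1/2\<close>, which handles all \<open>a < 1/2\<close>, negative ones
  included, by the same bound. In the constant, \<open>2\<^sup>s\<close> is \<open>\<langle>1\<rangle>\<^sup>s\<close>, \<open>1/4\<close> bounds the multiplier
  \<open>1 / (2 \<gamma>(1))\<close> from below, and \<open>exp (-1/4) * sqrt pi\<close> bounds the convolution.\<close>

lemma X_norm_product_ge:
  fixes N :: int
  assumes "a < 1 / 2" and "N \<ge> 1"
  defines "w \<equiv> gam N - gam (1 - N)"
  shows "X_norm s (- a) (\<lambda>(n, \<tau>). multiplier n *
      st_conv (mode N (gam N)) (mode (1 - N) (- gam (1 - N))) (n, \<tau>))
    \<ge> ennreal (2 powr s * exp (- 1 / 4) * sqrt pi / 4 * (5 * of_int N) powr (- 1 / 2))"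
proof -
  let ?h = "\<lambda>(n, \<tau>). multiplier n *
      st_conv (mode N (gam N)) (mode (1 - N) (- gam (1 - N))) (n, \<tau>)"
  define C where "C = 2 powr s * exp (- 1 / 4) * sqrt pi / 4 * (5 * of_int N) powr (- 1 / 2)"
  have C0: "C \<ge> 0" by (simp add: C_def)
  have g1: "1 \<le> gam 1" "gam 1 \<le> 3 / 2" using gam_bounds[of 1] by auto
  have w: "\<bar>w\<bar> \<le> 2 * of_int N"
    using gam_bounds[of N] gam_bounds[of "1 - N"] assms(2)
    unfolding w_def by (auto simp: power2_eq_square algebra_simps)
  have pt: "C \<le> cmod (of_real (\<langle>\<bar>\<tau>\<bar> - gam 1\<rangle> powr (- a) * \<langle>of_int 1\<rangle> powr s) * ?h (1, \<tau>))"
    if \<tau>: "\<tau> \<in> {w..w + 1}" for \<tau>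
  proof -
    have "\<langle>\<bar>\<tau>\<bar> - gam 1\<rangle> \<le> 5 * of_int N"
      using w \<tau> g1 assms(2) unfolding jbr_def by (simp add: abs_if split: if_splits)
    then have "(5 * of_int N) powr (- 1 / 2) \<le> \<langle>\<bar>\<tau>\<bar> - gam 1\<rangle> powr (- 1 / 2)"
      using jbr_ge_1[of "\<bar>\<tau>\<bar> - gam 1"] by (intro powr_mono2') auto
    also have "\<dots> \<le> \<langle>\<bar>\<tau>\<bar> - gam 1\<rangle> powr (- a)"
      using assms(1) jbr_ge_1 by (intro powr_mono) auto
    finally have 1: "(5 * of_int N) powr (- 1 / 2) \<le> \<langle>\<bar>\<tau>\<bar> - gam 1\<rangle> powr (- a)" .
    have "(\<tau> - w)\<^sup>2 \<le> 1\<^sup>2" using \<tau> by (intro power_mono) auto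
    then have 2: "exp (- 1 / 4) \<le> exp (- (\<tau> - w)\<^sup>2 / 4)" by simp
    have 3: "1 / 4 \<le> 1 / (2 * gam 1)" using g1 by (simp add: field_simps)
    have "cmod (?h (1, \<tau>)) = 1 / (2 * gam 1) * (sqrt pi * exp (- (\<tau> - w)\<^sup>2 / 4))"
      using st_conv_mode[of N "gam N" "1 - N" "- gam (1 - N)" \<tau>] g1
      by (simp add: multiplier_def norm_mult norm_divide w_def)
    then have "cmod (of_real (\<langle>\<bar>\<tau>\<bar> - gam 1\<rangle> powr (- a) * \<langle>of_int 1\<rangle> powr s) * ?h (1, \<tau>))
        = 2 powr s * \<langle>\<bar>\<tau>\<bar> - gam 1\<rangle> powr (- a) * (1 / (2 * gam 1) * (sqrt pi * exp (- (\<tau> - w)\<^sup>2 / 4)))"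
      by (simp add: norm_mult jbr_def)
    moreover have "2 powr s * (5 * of_int N) powr (- 1 / 2) * (1 / 4 * (sqrt pi * exp (- 1 / 4)))
      \<le> 2 powr s * \<langle>\<bar>\<tau>\<bar> - gam 1\<rangle> powr (- a) * (1 / (2 * gam 1) * (sqrt pi * exp (- (\<tau> - w)\<^sup>2 / 4)))"
      using 1 2 3 g1 by (intro mult_mono mult_left_mono) auto
    ultimately show ?thesis unfolding C_def by (simp add: mult_ac)
  qed
  have "ennreal (C\<^sup>2) = (\<integral>\<^sup>+ \<tau>. ennreal (C\<^sup>2) * indicator {w..w + 1} \<tau> \<partial>lborel)"
    by (subst nn_integral_cmult_indicator) auto
  also have "\<dots> = (\<integral>\<^sup>+ (n, \<tau>). (if n = 1 then ennreal (C\<^sup>2) * indicator {w..w + 1} \<tau> else 0) \<partial>freq_measure)"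
    by (rule nn_integral_freq_slice[symmetric]) auto
  also have "\<dots> \<le> (\<integral>\<^sup>+ p. ennreal ((cmod ((\<lambda>(n, \<tau>).
      of_real (\<langle>\<bar>\<tau>\<bar> - gam n\<rangle> powr (- a) * \<langle>of_int n\<rangle> powr s) * ?h (n, \<tau>)) p))\<^sup>2) \<partial>freq_measure)"
  proof (rule nn_integral_mono)
    fix p :: "int \<times> real"
    obtain n \<tau> where p: "p = (n, \<tau>)" by (cases p)
    have "(if n = 1 then ennreal (C\<^sup>2) * indicator {w..w + 1} \<tau> else 0)
      \<le> ennreal ((cmod (of_real (\<langle>\<bar>\<tau>\<bar> - gam n\<rangle> powr (- a) * \<langle>of_int n\<rangle> powr s) * ?h (n, \<tau>)))\<^sup>2)"
    proof (cases "n = 1 \<and> \<tau> \<in> {w..w + 1}")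
      case True
      then show ?thesis
        using ennreal_leI[OF power_mono[OF pt[of \<tau>] C0, of 2]] by simp
    qed auto
    then show "(case p of (n, \<tau>) \<Rightarrow> if n = 1 then ennreal (C\<^sup>2) * indicator {w..w + 1} \<tau> else 0)
      \<le> ennreal ((cmod ((\<lambda>(n, \<tau>). of_real (\<langle>\<bar>\<tau>\<bar> - gam n\<rangle> powr (- a) * \<langle>of_int n\<rangle> powr s)
          * ?h (n, \<tau>)) p))\<^sup>2)"
      unfolding p prod.case .
  qed
  finally show ?thesis
    unfolding X_norm_def C_def[symmetric] by (rule L2_norm_ge)
qed

theorem theorem1p2:
  fixes s a b :: real
  assumes "s < - 1 / 4" and "a < 1 / 2"
  shows "\<not> (\<exists>c > (0 :: real). \<forall>u \<in> X_space s b. \<forall>v \<in> X_space s b.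
           X_norm s (- a) (\<lambda>(n, \<tau>). multiplier n * st_conv u v (n, \<tau>))
             \<le> ennreal c * X_norm s b u * X_norm s b v)"
proof
  assume "\<exists>c > (0 :: real). \<forall>u \<in> X_space s b. \<forall>v \<in> X_space s b.
           X_norm s (- a) (\<lambda>(n, \<tau>). multiplier n * st_conv u v (n, \<tau>))
             \<le> ennreal c * X_norm s b u * X_norm s b v"
  then obtain c :: real where c: "c > 0" and est: "\<And>u v. u \<in> X_space s b \<Longrightarrow> v \<in> X_space s b \<Longrightarrow>
      X_norm s (- a) (\<lambda>(n, \<tau>). multiplier n * st_conv u v (n, \<tau>))
        \<le> ennreal c * X_norm s b u * X_norm s b v"
    by blast
  define B where "B = sqrt (exp (2 * b\<^sup>2) * sqrt (2 * pi))"
  define A where "A = 2 powr s * exp (- 1 / 4) * sqrt pi / 4 * 5 powr (- 1 / 2)"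
  have B: "B > 0" and A: "A > 0" by (auto simp: B_def A_def)
  have bound: "real N powr (- 1 / 2 - 2 * s) \<le> c * B\<^sup>2 / A" if N: "N \<ge> 1" for N :: nat
  proof -
    let ?u = "mode (int N) (gam (int N))" and ?v = "mode (1 - int N) (- gam (1 - int N))"
    have gam: "\<bar>gam n\<bar> = gam n" "\<bar>- gam n\<bar> = gam n" for n
      by (auto simp: gam_def)
    \<comment> \<open>For negative \<open>s\<close> the power \<open>N\<^sup>s\<close> dominates \<open>(1 + N)\<^sup>s\<close>, and \<open>\<langle>1 - N\<rangle>\<close> is exactly \<open>N\<close>.\<close>
    have "\<langle>of_int (int N)\<rangle> powr s \<le> real N powr s"
      using N assms(1) by (intro powr_mono2') (auto simp: jbr_def)
    then have u: "X_norm s b ?u \<le> ennreal (B * real N powr s)"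
      using X_norm_mode_le[OF gam(1), of s b "int N"] B
      by (auto simp: B_def intro: order_trans ennreal_leI mult_left_mono)
    have "\<langle>of_int (1 - int N)\<rangle> = real N"
      using N by (simp add: jbr_def)
    then have v: "X_norm s b ?v \<le> ennreal (B * real N powr s)"
      using X_norm_mode_le[OF gam(2), of s b "1 - int N"] by (simp add: B_def)
    have "ennreal (A * real N powr (- 1 / 2)) \<le> X_norm s (- a) (\<lambda>(n, \<tau>). multiplier n * st_conv ?u ?v (n, \<tau>))"
      using X_norm_product_ge[OF assms(2), of "int N" s] N
      by (simp add: A_def powr_mult mult_ac)
    also have "\<dots> \<le> ennreal c * X_norm s b ?u * X_norm s b ?v"
      by (intro est mode_in_X_space gam)
    also have "\<dots> \<le> ennreal c * ennreal (B * real N powr s) * ennreal (B * real N powr s)"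
      by (intro mult_mono u v) auto
    also have "\<dots> = ennreal (c * B\<^sup>2 * real N powr (2 * s))"
      using c B by (simp add: ennreal_mult[symmetric] power2_eq_square powr_add[symmetric] mult_ac)
    finally have "A * real N powr (- 1 / 2) \<le> c * B\<^sup>2 * real N powr (2 * s)"
      using c B by (subst (asm) ennreal_le_iff) auto
    then show ?thesis
      using A N by (simp add: powr_diff pos_le_divide_eq pos_divide_le_eq mult.commute)
  qed
  have "filterlim (\<lambda>N. real N powr (- 1 / 2 - 2 * s)) at_top sequentially"
    using assms(1) by real_asymp
  then have "eventually (\<lambda>N. real N powr (- 1 / 2 - 2 * s) > c * B\<^sup>2 / A \<and> N \<ge> 1) sequentially"
    by (intro eventually_conj eventually_ge_at_top) (simp add: filterlim_at_top_dense)
  then obtain N where "real N powr (- 1 / 2 - 2 * s) > c * B\<^sup>2 / A" "N \<ge> 1"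
    by (auto simp: eventually_sequentially)
  with bound[of N] show False by linarith
qed

end
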